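(* Let $0\le\epsilon$, $0\le\delta,\eta\le1$, let $D_{\mathcal X^n}$ be a probability distribution on $\mathcal X^n$, and let $q$ be a query. If a mechanism $M:\mathcal X^n\times\mathcal Q\to\mathcal R$ is $(\epsilon,\delta,\eta)$-Typically-Stable with respect to $D_{\mathcal X^n}$ and $q$, then it satisfies $(\epsilon,\delta+2\eta)$-Local-Max-Information (LMI) with respect to the same $D_{\mathcal X^n}$ and $q$.
   Context: $\mathcal X$, $\mathcal Q$, $\mathcal R$ are countable sets and $n\in\mathbb N$. A mechanism is a possibly randomized function $M:\mathcal X^n\times\mathcal Q\to\mathcal R$; for fixed $q$ write $D(r\mid s)=\Pr[M(s,q)=r]$ and $D(\mathbf r\mid s)=\Pr[M(s,q)\in\mathbf r]$. Typical Stability: $M$ is $(\epsilon,\delta,\eta)$-Typically-Stable with respect to $D_{\mathcal X^n},q$ if, for $S_1,S_2$ drawn independently from $D_{\mathcal X^n}$, $\Pr\left[\exists\,\mathbf r\subseteq\mathcal R:\ D(\mathbf r\mid S_1)>e^\epsilon D(\mathbf r\mid S_2)+\delta\right]<\eta$. Induced distributions: $D(s)=D_{\mathcal X^n}(s)$, $D(r)=\sum_sD(s)D(r\mid s)$, $D(x\mid s)=\frac1n|\{i:s_i=x\}|$, $D(x)=\sum_sD(s)D(x\mid s)$. On $\mathcal X\times\mathcal R$: joint $D_{(\mathcal X,\mathcal R)}(x,r)=\sum_sD(s)D(x\mid s)D(r\mid s)$ and product $D_{\mathcal X\otimes\mathcal R}(x,r)=D(x)D(r)$. Local Max Information: $M$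 satisfies $(\epsilon,\delta)$-LMI with respect to $D_{\mathcal X^n},q$ if for every $\mathbf b\subseteq\mathcal X\times\mathcal R$, $D_{(\mathcal X,\mathcal R)}(\mathbf b)\le e^\epsilon D_{\mathcal X\otimes\mathcal R}(\mathbf b)+\delta$ and $D_{\mathcal X\otimes\mathcal R}(\mathbf b)\le e^\epsilon D_{(\mathcal X,\mathcal R)}(\mathbf b)+\delta$. (The same inequalities are used when the second parameter exceeds 1.) *)

theory Defs
  imports "HOL-Probability.Probability"
begin

text \<open>
  A sample in \<open>\<X>\<^sup>n\<close> is a vector of type \<open>'x ^ 'n\<close>, so \<open>n = CARD('n)\<close>, and a randomized
  function is one whose values are probability mass functions.
\<close>

type_synonym ('x, 'n, 'q, 'r) mechanism = "('x ^ 'n) \<times> 'q \<Rightarrow> 'r pmf"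

definition typically_stable ::
  "real \<Rightarrow> real \<Rightarrow> real \<Rightarrow> ('x, 'n::finite, 'q, 'r) mechanism \<Rightarrow> ('x ^ 'n) pmf \<Rightarrow> 'q \<Rightarrow> bool"
  where "typically_stable \<epsilon> \<delta> \<eta> M D q \<longleftrightarrow>
    measure_pmf.prob (pair_pmf D D)
      {(s1, s2). \<exists>R. measure_pmf.prob (M (s1, q)) R
                    > exp \<epsilon> * measure_pmf.prob (M (s2, q)) R + \<delta>} < \<eta>"

text \<open>The lemmas \<open>pmf_*\<close> give the mass functions of the induced distributions as explicit sums.\<close>

definition output_dist :: "('x, 'n::finite, 'q, 'r) mechanism \<Rightarrow> ('x ^ 'n) pmf \<Rightarrow> 'q \<Rightarrow> 'r pmf"
  where "output_dist M D q = bind_pmf D (\<lambda>s. M (s, q))"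

definition empirical_dist :: "'x ^ 'n::finite \<Rightarrow> 'x pmf"
  where "empirical_dist s = map_pmf (\<lambda>i. s $ i) (pmf_of_set UNIV)"

definition element_dist :: "('x ^ 'n::finite) pmf \<Rightarrow> 'x pmf"
  where "element_dist D = bind_pmf D empirical_dist"

definition joint_dist ::
  "('x, 'n::finite, 'q, 'r) mechanism \<Rightarrow> ('x ^ 'n) pmf \<Rightarrow> 'q \<Rightarrow> ('x \<times> 'r) pmf"
  where "joint_dist M D q = bind_pmf D (\<lambda>s. pair_pmf (empirical_dist s) (M (s, q)))"

definition product_dist ::
  "('x, 'n::finite, 'q, 'r) mechanism \<Rightarrow> ('x ^ 'n) pmf \<Rightarrow> 'q \<Rightarrow> ('x \<times> 'r) pmf"
  where "product_dist M D q = pair_pmf (element_dist D) (output_dist M D q)"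

lemma pmf_empirical_dist:
  fixes s :: "'x ^ 'n::finite"
  shows "pmf (empirical_dist s) x = real (card {i. s $ i = x}) / real CARD('n)"
  by (simp add: empirical_dist_def pmf_map measure_pmf_of_set vimage_def)

lemma pmf_bind_infsum: "pmf (bind_pmf D f) y = (\<Sum>\<^sub>\<infinity>s. pmf D s * pmf (f s) y)"
proof -
  have "Infinite_Set_Sum.abs_summable_on (\<lambda>s. pmf D s * pmf (f s) y) UNIV"
    by (rule abs_summable_on_comparison_test[OF pmf_abs_summable[of D]])
       (auto simp: pmf_le_1 mult_left_le)
  then show ?thesis
    by (simp add: pmf_bind pmf_expectation_eq_infsetsum infsetsum_infsum)
qed

lemma pmf_output_dist:
  "pmf (output_dist M D q) r = (\<Sum>\<^sub>\<infinity>s. pmf D s * pmf (M (s, q)) r)"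
  by (simp add: output_dist_def pmf_bind_infsum)

lemma pmf_element_dist:
  "pmf (element_dist D) x = (\<Sum>\<^sub>\<infinity>s. pmf D s * pmf (empirical_dist s) x)"
  by (simp add: element_dist_def pmf_bind_infsum)

lemma pmf_joint_dist:
  "pmf (joint_dist M D q) (x, r) =
     (\<Sum>\<^sub>\<infinity>s. pmf D s * pmf (empirical_dist s) x * pmf (M (s, q)) r)"
  by (simp add: joint_dist_def pmf_bind_infsum pmf_pair mult.assoc)

lemma pmf_product_dist:
  "pmf (product_dist M D q) (x, r) = pmf (element_dist D) x * pmf (output_dist M D q) r"
  by (simp add: product_dist_def pmf_pair)

definition local_max_information ::
  "real \<Rightarrow> real \<Rightarrow> ('x, 'n::finite, 'q, 'r) mechanism \<Rightarrow> ('x ^ 'n) pmf \<Rightarrow> 'q \<Rightarrow> bool"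
  where "local_max_information \<epsilon> \<delta> M D q \<longleftrightarrow>
    (\<forall>B. measure_pmf.prob (joint_dist M D q) B
            \<le> exp \<epsilon> * measure_pmf.prob (product_dist M D q) B + \<delta> \<and>
         measure_pmf.prob (product_dist M D q) B
            \<le> exp \<epsilon> * measure_pmf.prob (joint_dist M D q) B + \<delta>)"

end

theory Submission
  imports Defs
begin

text \<open>
  With \<open>s1\<close> and \<open>s2\<close> drawn independently, both the joint and the product distribution draw the element
  from \<open>s1\<close>; they differ only in running the mechanism on \<open>s1\<close> or on \<open>s2\<close>.  Given \<open>(s1, s2)\<close> these two
  conditional laws are \<open>(\<epsilon>, \<delta>)\<close>-close unless the pair belongs to the exceptional event of typical
  stability, and that event costs at most \<open>\<eta>\<close>.  The reverse inequality uses the exchangeability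
  of \<open>(s1, s2)\<close>.
\<close>

lemma measure_bind_pmf_expectation:
  "measure_pmf.prob (bind_pmf p K) B = measure_pmf.expectation p (\<lambda>w. measure_pmf.prob (K w) B)"
  using measurable_measure_pmf[of K] unfolding measure_pmf_bind
  by (subst measure_pmf.measure_bind[where N = "count_space UNIV"]) auto

lemma integrable_measure_pmf_prob:
  "integrable (measure_pmf p) (\<lambda>w. measure_pmf.prob (K w) B)"
  by (rule measure_pmf.integrable_const_bound[where B = 1]) auto

text \<open>Integrate the pointwise bound over \<open>p\<close>. On \<open>E\<close> nothing is
  known about \<open>K w\<close>, but its probability is at most 1, so adding the indicator of
  \<open>E\<close> restores the bound; that indicator integrates to the probability of
  \<open>E\<close>.\<close>

lemma measure_bind_pmf_le:
  assumes "0 \<le> c" and "0 \<le> d"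
    and E: "\<And>w. w \<notin> E \<Longrightarrow> measure_pmf.prob (K w) B \<le> c * measure_pmf.prob (L w) B + d"
  shows "measure_pmf.prob (bind_pmf p K) B
           \<le> c * measure_pmf.prob (bind_pmf p L) B + d + measure_pmf.prob p E"
proof -
  have "measure_pmf.prob (bind_pmf p K) B
      \<le> measure_pmf.expectation p (\<lambda>w. c * measure_pmf.prob (L w) B + d + indicator E w)"
    unfolding measure_bind_pmf_expectation
  proof (rule integral_mono)
    fix w
    have "measure_pmf.prob (K w) B \<le> 1" and "0 \<le> c * measure_pmf.prob (L w) B"
      using \<open>0 \<le> c\<close> by simp_all
    then show "measure_pmf.prob (K w) B \<le> c * measure_pmf.prob (L w) B + d + indicator E w"
      using E[of w] \<open>0 \<le> d\<close> by (cases "w \<in> E") (simp_all del: measure_pmf.prob_le_1)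
  qed (simp_all add: integrable_measure_pmf_prob measure_pmf.integrable_const_bound[where B = 1])
  also have "\<dots> = c * measure_pmf.prob (bind_pmf p L) B + d + measure_pmf.prob p E"
    by (simp add: measure_bind_pmf_expectation integrable_measure_pmf_prob
        measure_pmf.integrable_const_bound[where B = 1])
  finally show ?thesis .
qed

text \<open>Conditioned on the first coordinate \<open>x\<close>, the event \<open>B\<close> becomes
  its slice at \<open>x\<close>, to which the assumption applies. Averaging over \<open>x\<close> is
  the previous lemma with an empty exceptional set.\<close>

lemma measure_pair_pmf_le:
  fixes p :: "'a pmf" and N N' :: "'b pmf"
  assumes "0 \<le> c" and "0 \<le> d"
    and "\<And>R. measure_pmf.prob N R \<le> c * measure_pmf.prob N' R + d"
  shows "measure_pmf.prob (pair_pmf p N) B \<le> c * measure_pmf.prob (pair_pmf p N') B + d"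
proof -
  have pair: "pair_pmf p L = bind_pmf p (\<lambda>x. map_pmf (Pair x) L)" for L :: "'b pmf"
    by (simp add: pair_pmf_def map_pmf_def)
  show ?thesis
    using measure_bind_pmf_le[where E = "{}" and K = "\<lambda>x. map_pmf (Pair x) N"
        and L = "\<lambda>x. map_pmf (Pair x) N'" and B = B, OF assms(1,2)] assms(3)
    by (simp add: pair)
qed

text \<open>The second sample is a dummy: it puts the joint distribution over the same mixing law as
  the product distribution, so that the two can be compared pair by pair.\<close>

lemma joint_dist_eq_bind_pair:
  "joint_dist M D q =
     bind_pmf (pair_pmf D D) (\<lambda>(s1, s2). pair_pmf (empirical_dist s1) (M (s1, q)))"
  by (simp add: joint_dist_def pair_pmf_def bind_assoc_pmf bind_return_pmf)

lemma product_dist_eq_bind_pair: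
  "product_dist M D q =
     bind_pmf (pair_pmf D D) (\<lambda>(s1, s2). pair_pmf (empirical_dist s1) (M (s2, q)))"
  unfolding product_dist_def element_dist_def output_dist_def pair_pmf_def
    bind_assoc_pmf bind_return_pmf prod.case
  \<comment> \<open>Drawing the element from \<open>s1\<close> is independent of drawing
    \<open>s2\<close>, so the two draws may be exchanged.\<close>
  by (subst bind_commute_pmf) (rule refl)

theorem theorem4p10:
  fixes M :: "('x::countable, 'n::finite, 'q::countable, 'r::countable) mechanism"
    and D :: "('x ^ 'n) pmf"
    and q :: 'q
    and \<epsilon> \<delta> \<eta> :: real
  assumes "0 \<le> \<epsilon>"
    and "0 \<le> \<delta>" and "\<delta> \<le> 1"
    and "0 \<le> \<eta>" and "\<eta> \<le> 1"
    and "typically_stable \<epsilon> \<delta> \<eta> M D q"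
  shows "local_max_information \<epsilon> (\<delta> + 2 * \<eta>) M D q"
proof -
  let ?P = "\<lambda>s. measure_pmf.prob (M (s, q))"
  let ?K = "\<lambda>s t. pair_pmf (empirical_dist s) (M (t, q))"
  define E where "E = {(s1, s2). \<exists>R. ?P s1 R > exp \<epsilon> * ?P s2 R + \<delta>}"
  \<comment> \<open>The reverse inequality compares a run on \<open>s2\<close> with a run on
    \<open>s1\<close>, so its exceptional pairs are those of \<open>E\<close> with coordinates
    swapped.\<close>
  define E' where "E' = (\<lambda>(s1, s2). (s2, s1)) -` E"
  have E: "measure_pmf.prob (pair_pmf D D) E < \<eta>"
    using assms unfolding typically_stable_def E_def by blast
  have "measure_pmf.prob (pair_pmf D D) E' = measure_pmf.prob (map_pmf (\<lambda>(s1, s2). (s2, s1)) (pair_pmf D D)) E"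
    by (simp add: E'_def)
  also have "map_pmf (\<lambda>(s1, s2). (s2, s1)) (pair_pmf D D) = pair_pmf D D"
    by (rule pair_commute_pmf[symmetric])
  finally have E': "measure_pmf.prob (pair_pmf D D) E' < \<eta>"
    using E by simp
  have close: "measure_pmf.prob (?K s t) B \<le> exp \<epsilon> * measure_pmf.prob (?K s u) B + \<delta>"
    if "(t, u) \<notin> E" for s t u B
    using that \<open>0 \<le> \<delta>\<close> by (intro measure_pair_pmf_le) (auto simp: E_def not_less)
  have "measure_pmf.prob (joint_dist M D q) B
      \<le> exp \<epsilon> * measure_pmf.prob (product_dist M D q) B + \<delta> + measure_pmf.prob (pair_pmf D D) E" for B
    unfolding joint_dist_eq_bind_pair product_dist_eq_bind_pair
    using \<open>0 \<le> \<delta>\<close> by (intro measure_bind_pmf_le) (auto intro: close)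
  moreover have "measure_pmf.prob (product_dist M D q) B
      \<le> exp \<epsilon> * measure_pmf.prob (joint_dist M D q) B + \<delta> + measure_pmf.prob (pair_pmf D D) E'" for B
    unfolding joint_dist_eq_bind_pair product_dist_eq_bind_pair
    using \<open>0 \<le> \<delta>\<close> by (intro measure_bind_pmf_le) (auto intro: close simp: E'_def)
  \<comment> \<open>Each direction pays for a single exceptional event, which gives \<delta> +
    \<eta>, and this is at most \<delta> + 2\<eta>.\<close>
  ultimately show ?thesis
    unfolding local_max_information_def using E E' \<open>0 \<le> \<eta>\<close>
    by (smt (verit, best))
qed

end
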